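(* Let $n\ge 1$ and let $\pi\in S_n$ have LTR-max decomposition $\pi=M_1P_1M_2P_2\cdots M_{k-1}P_{k-1}M_k$ with $M_k\neq\emptyset$ (equivalently $\pi_n=n$), and suppose $\pi\neq 12\cdots n$. Let $M'_{k-1}$ be the (possibly empty) sequence obtained from $M_{k-1}$ by removing its last entry $\mu_{k-1}$, let $M'_k$ be the (possibly empty) sequence obtained from $M_k$ by removing $n$, and let $\pi'\in S_{n-1}$ be obtained from $\pi$ by deleting $n$. Then a permutation $\sigma\in S_n$ satisfies $q(\sigma)=\pi$ if and only if exactly one of the following holds: (1) $\sigma=\tau\,\mu_{k-1}P_{k-1}M'_k$ (concatenation), where $\tau$ is an arrangement of the entries of $M_1P_1\cdots M_{k-2}P_{k-2}M'_{k-1}$ together with $n$ whose standardization is a preimage under $q$ of the standardization of the sequence $M_1P_1\cdots M_{k-2}P_{k-2}M'_{k-1}\,n$; (2) there is $\sigma'\in S_{n-1}$ with $q(\sigma')=\pi'$, with LTR-max decomposition $\sigma'=N_1R_1\cdots N_{s-1}R_{s-1}N_s$, such that $\sigma$ is obtained from $\sigma'$ by inserting $n$ in some position to the right of $N_{s-1}$ (that is, immediately after the last entry of $N_{s-1}$ or immediately after some entry of $R_{s-1}N_s$).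
   Context: $S_n$ is the set of permutations of $\{1,\dots,n\}$ in one-line notation $\pi=\pi_1\cdots\pi_n$. An entry $\pi_i$ is a left-to-right (LTR) maximum if $\pi_i>\pi_j$ for all $j<i$. The map $q:S_n\to S_n$ (the algorithm Queuesort, sorting with a queue allowing bypass) is described as follows: let $m_1,\dots,m_r$ be the LTR maxima of $\pi$ from left to right; for $i=r,r-1,\dots,1$ in this order, repeatedly swap $m_i$ with the entry immediately to its right as long as such an entry exists and is smaller than $m_i$; the result is $q(\pi)$ (e.g. $q(21543)=12435$). A preimage of $\pi$ is any $\sigma$ with $q(\sigma)=\pi$. The LTR-max decomposition of $\pi$ is the factorization $\pi=M_1P_1M_2P_2\cdots M_{k-1}P_{k-1}M_k$ into consecutive factors, where the $M_i$ are the maximal factors consisting of consecutive LTR maxima and the $P_i$ are the nonempty factors between them consisting of non-LTR-maxima; $M_1,\dots,M_{k-1}$ are nonempty, $M_k$ may be empty. When entries are removed from or collected out of a permutation, the resulting sequence is identified with a permutation via standardization (replace the $r$-th smallest value by $r$). *)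

theory Defs
  imports "HOL-Combinatorics.Multiset_Permutations"
begin

text \<open>The symmetric group of degree \<open>n\<close> in one-line notation is
  \<^term>\<open>permutations_of_set {1..n::nat}\<close>, a set of lists without repetitions.
  The definitions below are meant for lists without repetitions, so that an entry
  determines its position.\<close>

definition ltr_maxima :: "nat list \<Rightarrow> nat list" where
  "ltr_maxima xs = map ((!) xs) (filter (\<lambda>i. \<forall>j<i. xs ! j < xs ! i) [0..<length xs])"

text \<open>Repeatedly swap the entry \<open>m\<close> with its right neighbour as long as that neighbour
  exists and is smaller.\<close>

fun bubble :: "nat \<Rightarrow> nat list \<Rightarrow> nat list" where
  "bubble m (x # y # ys) =
     (if x = m \<and> y < m then y # bubble m (x # ys) else x # bubble m (y # ys))"
| "bubble m xs = xs"

text \<open>The LTR maxima are those of the input list; \<^const>\<open>foldr\<close> processes the last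
  (rightmost) of them first.\<close>

definition queuesort :: "nat list \<Rightarrow> nat list" where
  "queuesort xs = foldr bubble (ltr_maxima xs) xs"

definition standardize :: "nat list \<Rightarrow> nat list" where
  "standardize xs = map (\<lambda>x. card {y \<in> set xs. y \<le> x}) xs"

text \<open>\<open>factor_product M P j\<close> is the concatenation \<open>M\<^sub>1 P\<^sub>1 M\<^sub>2 P\<^sub>2 \<dots> M\<^sub>j P\<^sub>j\<close>.\<close>

definition factor_product :: "(nat \<Rightarrow> nat list) \<Rightarrow> (nat \<Rightarrow> nat list) \<Rightarrow> nat \<Rightarrow> nat list" where
  "factor_product M P j = concat (map (\<lambda>i. M i @ P i) [1..<Suc j])"

text \<open>\<open>M\<^sub>1 P\<^sub>1 \<dots> M\<^sub>k\<^sub>-\<^sub>1 P\<^sub>k\<^sub>-\<^sub>1 M\<^sub>k\<close> is the LTR-max decomposition of \<open>xs\<close>. The blocks \<open>M i\<close> are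
  automatically maximal because the blocks \<open>P i\<close> between them are nonempty and contain no
  LTR maximum. Only the values \<open>M i\<close> for \<open>1 \<le> i \<le> k\<close> and \<open>P i\<close> for \<open>1 \<le> i < k\<close> matter.\<close>

definition ltr_max_decomposition ::
  "nat list \<Rightarrow> nat \<Rightarrow> (nat \<Rightarrow> nat list) \<Rightarrow> (nat \<Rightarrow> nat list) \<Rightarrow> bool" where
  "ltr_max_decomposition xs k M P \<longleftrightarrow>
     k \<ge> 1 \<and>
     xs = factor_product M P (k - 1) @ M k \<and>
     (\<forall>i\<in>{1..k}. set (M i) \<subseteq> set (ltr_maxima xs)) \<and>
     (\<forall>i\<in>{1..<k}. set (P i) \<inter> set (ltr_maxima xs) = {}) \<and>
     (\<forall>i\<in>{1..<k}. M i \<noteq> [] \<and> P i \<noteq> [])"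

end

theory Submission
  imports Defs
begin

text \<open>Write \<open>\<sigma> = L n R\<close> and let \<open>F\<close> bubble the LTR maxima of \<open>L\<close>. Then
  \<open>q(\<sigma>) = F(L R) n\<close>. Split \<open>\<sigma>' = L R\<close> as \<open>A \<mu> P T\<close>, where \<open>\<mu>\<close> is the last LTR maximum that
  precedes a smaller entry and \<open>T\<close> is the final run of LTR maxima. If \<open>n\<close> lies to the right of
  \<open>\<mu>\<close>, then the LTR maxima of \<open>\<sigma>'\<close> in \<open>R\<close> all belong to \<open>T\<close>, so they do not move and
  \<open>q(\<sigma>) = q(\<sigma>') n\<close>: case (2). Otherwise \<open>\<mu> P T\<close> is not touched by \<open>F\<close>, since \<open>\<mu>\<close> exceeds all
  entries of \<open>A\<close>; hence \<open>\<mu> P T\<close> is the corresponding part of \<open>\<pi>\<close>: case (1).\<close>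

section \<open>LTR maxima\<close>

lemma ltr_maxima_Nil [simp]: "ltr_maxima [] = []"
  by (simp add: ltr_maxima_def)

lemma ltr_maxima_snoc:
  "ltr_maxima (xs @ [x]) = ltr_maxima xs @ (if \<forall>y\<in>set xs. y < x then [x] else [])"
proof -
  have "map ((!) (xs @ [x])) (filter (\<lambda>i. \<forall>j<i. (xs @ [x]) ! j < (xs @ [x]) ! i) [0..<length xs])
      = map ((!) xs) (filter (\<lambda>i. \<forall>j<i. xs ! j < xs ! i) [0..<length xs])"
    by (auto simp: nth_append intro!: map_cong filter_cong)
  then show ?thesis
    by (auto simp: ltr_maxima_def nth_append all_set_conv_all_nth)
qed

lemma set_ltr_maxima_subset: "set (ltr_maxima xs) \<subseteq> set xs"
  by (induction xs rule: rev_induct) (auto simp: ltr_maxima_snoc)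

lemma ltr_maxima_append:
  obtains ms where "ltr_maxima (xs @ ys) = ltr_maxima xs @ ms" "set ms \<subseteq> set ys"
proof -
  have "\<exists>ms. ltr_maxima (xs @ ys) = ltr_maxima xs @ ms \<and> set ms \<subseteq> set ys"
  proof (induction ys rule: rev_induct)
    case (snoc y ys)
    then show ?case
      using ltr_maxima_snoc[of "xs @ ys" y] by auto
  qed simp
  with that show thesis by blast
qed

text \<open>Distinctness lets membership of the value \<open>x\<close> speak about its position:
  \<open>x\<close> occurs neither among the maxima of \<open>A\<close> nor among those contributed
  by \<open>B\<close>.\<close>

lemma in_ltr_maxima_iff:
  assumes "distinct (A @ x # B)"
  shows "x \<in> set (ltr_maxima (A @ x # B)) \<longleftrightarrow> (\<forall>a\<in>set A. a < x)"
proof -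
  obtain ms where ms: "ltr_maxima ((A @ [x]) @ B) = ltr_maxima (A @ [x]) @ ms" "set ms \<subseteq> set B"
    by (rule ltr_maxima_append)
  then have "x \<notin> set ms" "x \<notin> set (ltr_maxima A)"
    using assms set_ltr_maxima_subset[of A] by auto
  moreover have "ltr_maxima (A @ x # B) = ltr_maxima A @ (if \<forall>a\<in>set A. a < x then [x] else []) @ ms"
    using ms(1) by (simp add: ltr_maxima_snoc)
  ultimately show ?thesis
    by (cases "\<forall>a\<in>set A. a < x") auto
qed

text \<open>\<open>n\<close> dominates everything behind it, so \<open>R\<close> contributes no
  maximum.\<close>

lemma ltr_maxima_Cons_greatest:
  assumes "\<forall>x\<in>set L. x < n" "\<forall>x\<in>set R. x < n"
  shows "ltr_maxima (L @ n # R) = ltr_maxima L @ [n]"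
  using assms(2)
proof (induction R rule: rev_induct)
  case Nil
  then show ?case using assms(1) by (simp add: ltr_maxima_snoc)
next
  case (snoc r R)
  then show ?case using ltr_maxima_snoc[of "L @ n # R" r] by auto
qed

lemma ltr_maxima_map:
  assumes "strict_mono_on (set xs) f"
  shows "ltr_maxima (map f xs) = map f (ltr_maxima xs)"
  using assms
proof (induction xs rule: rev_induct)
  case (snoc x xs)
  have "(\<forall>y\<in>set xs. f y < f x) \<longleftrightarrow> (\<forall>y\<in>set xs. y < x)"
    using snoc.prems by (auto simp: strict_mono_on_less)
  moreover have "strict_mono_on (set xs) f"
    using snoc.prems by (auto simp: strict_mono_on_def)
  ultimately show ?case using snoc.IH by (simp add: ltr_maxima_snoc)
qed simp

section \<open>Bubbling\<close>

lemma mset_bubble [simp]: "mset (bubble m xs) = mset xs"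
  by (induction m xs rule: bubble.induct) auto

lemma mset_foldr_bubble [simp]: "mset (foldr bubble ms xs) = mset xs"
  by (induction ms) auto

lemma set_foldr_bubble [simp]: "set (foldr bubble ms xs) = set xs"
  by (metis mset_foldr_bubble set_mset_mset)

lemma set_queuesort [simp]: "set (queuesort xs) = set xs"
  by (simp add: queuesort_def)

lemma bubble_append_left: "m \<notin> set A \<Longrightarrow> bubble m (A @ ys) = A @ bubble m ys"
proof (induction A)
  case (Cons a A)
  then show ?case by (cases "A @ ys") auto
qed simp

lemma bubble_notin [simp]: "m \<notin> set xs \<Longrightarrow> bubble m xs = xs"
  using bubble_append_left[of m xs "[]"] by simp

text \<open>A larger entry \<open>y\<close> is a barrier that \<open>m\<close> cannot pass, which
  confines all movement to \<open>xs\<close>.\<close>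

lemma bubble_append_right:
  "m < y \<Longrightarrow> m \<notin> set ys \<Longrightarrow> bubble m (xs @ y # ys) = bubble m xs @ y # ys"
proof (induction m xs rule: bubble.induct)
  case ("2_2" m x)
  then show ?case by simp
qed auto

lemma foldr_bubble_append_right:
  assumes "\<forall>m\<in>set ms. m < y \<and> m \<notin> set ys"
  shows "foldr bubble ms (xs @ y # ys) = foldr bubble ms xs @ y # ys"
  using assms by (induction ms) (auto simp: bubble_append_right)

lemma bubble_to_end: "\<forall>x\<in>set R. x < m \<Longrightarrow> bubble m (m # R) = R @ [m]"
  by (induction R) auto

lemma bubble_idle:
  assumes "m \<notin> set Z" "\<forall>x\<in>set T. m < x"
  shows "bubble m (Z @ m # T) = Z @ m # T"
  using assms by (cases T) (auto simp: bubble_append_left)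

lemma foldr_bubble_idle: "\<forall>m\<in>set ms. bubble m xs = xs \<Longrightarrow> foldr bubble ms xs = xs"
  by (induction ms) auto

text \<open>Bubbling only tests equality with \<open>m\<close> and compares with \<open>m\<close>,
  so order embeddings preserve it. The domain includes \<open>m\<close> because \<open>m\<close>
  need not occur in \<open>xs\<close>, in particular not in the tails met during the
  recursion.\<close>

lemma bubble_map:
  assumes "strict_mono_on (insert m (set xs)) f"
  shows "bubble (f m) (map f xs) = map f (bubble m xs)"
  using assms
proof (induction m xs rule: bubble.induct)
  case (1 m x y ys)
  have "f x = f m \<longleftrightarrow> x = m" "f y < f m \<longleftrightarrow> y < m"
    using "1.prems" by (simp_all add: strict_mono_on_less inj_on_eq_iff[OF strict_mono_on_imp_inj_on])
  moreover have "strict_mono_on (insert m (set (x # ys))) f"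
    "strict_mono_on (insert m (set (y # ys))) f"
    using "1.prems" by (auto simp: strict_mono_on_def)
  ultimately show ?case using "1.IH" by auto
qed auto

lemma foldr_bubble_map:
  assumes "strict_mono_on (set xs) f" "set ms \<subseteq> set xs"
  shows "foldr bubble (map f ms) (map f xs) = map f (foldr bubble ms xs)"
  using assms(2) by (induction ms) (auto simp: bubble_map insert_absorb assms(1))

lemma queuesort_map:
  "strict_mono_on (set xs) f \<Longrightarrow> queuesort (map f xs) = map f (queuesort xs)"
  by (simp add: queuesort_def ltr_maxima_map foldr_bubble_map set_ltr_maxima_subset)

text \<open>Ranks increase strictly on the entries, so \<open>queuesort\<close> commutes with
  standardization. Equal entry sets give one common rank function \<open>f\<close>, which is
  cancelled by injectivity.\<close>

lemma queuesort_standardize_eq_iff: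
  assumes "set xs = set ys"
  shows "queuesort (standardize xs) = standardize ys \<longleftrightarrow> queuesort xs = ys"
proof -
  define f where "f = (\<lambda>x. card {y \<in> set xs. y \<le> x})"
  have mono: "strict_mono_on (set xs) f"
  proof (rule strict_mono_onI)
    fix x y assume "x \<in> set xs" "y \<in> set xs" "x < y"
    then have "y \<in> {z \<in> set xs. z \<le> y} - {z \<in> set xs. z \<le> x}"
      "{z \<in> set xs. z \<le> x} \<subseteq> {z \<in> set xs. z \<le> y}" by auto
    then have "{z \<in> set xs. z \<le> x} \<subset> {z \<in> set xs. z \<le> y}" by blast
    then show "f x < f y" unfolding f_def by (intro psubset_card_mono) auto
  qed
  have "standardize xs = map f xs" "standardize ys = map f ys"
    by (simp_all add: standardize_def f_def assms)
  moreover have "inj_on f (set (queuesort xs) \<union> set ys)"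
    using strict_mono_on_imp_inj_on[OF mono] assms by simp
  ultimately show ?thesis
    using queuesort_map[OF mono] inj_on_map_eq_map by metis
qed

text \<open>\<open>n\<close> is the last LTR maximum, so \<open>foldr\<close> bubbles it first and
  it travels to the end. There it is a barrier for the maxima of \<open>L\<close>.\<close>

lemma queuesort_Cons_greatest:
  assumes "\<forall>x\<in>set L. x < n" "\<forall>x\<in>set R. x < n"
  shows "queuesort (L @ n # R) = foldr bubble (ltr_maxima L) (L @ R) @ [n]"
proof -
  have "n \<notin> set L" using assms by auto
  then have "queuesort (L @ n # R) = foldr bubble (ltr_maxima L) ((L @ R) @ [n])"
    using assms by (simp add: queuesort_def ltr_maxima_Cons_greatest bubble_append_left bubble_to_end)
  also have "\<dots> = foldr bubble (ltr_maxima L) (L @ R) @ [n]"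
    using assms set_ltr_maxima_subset[of L] by (intro foldr_bubble_append_right) auto
  finally show ?thesis .
qed

section \<open>The final split of a permutation\<close>

text \<open>The last three blocks of an LTR-max decomposition, with \<open>m\<close> the last entry of the
  penultimate block of LTR maxima.\<close>

definition final_split ::
  "nat list \<Rightarrow> nat list \<Rightarrow> nat \<Rightarrow> nat list \<Rightarrow> nat list \<Rightarrow> bool" where
  "final_split xs A m P T \<longleftrightarrow> xs = A @ m # P @ T \<and> P \<noteq> [] \<and>
     (\<forall>x\<in>set A \<union> set P. x < m) \<and> (\<forall>x\<in>set T. m < x) \<and> sorted_wrt (<) T"

text \<open>Otherwise \<open>T\<close> would contain the last entry \<open>p\<close> of
  \<open>P'\<close>. Then everything before \<open>p\<close> is smaller than \<open>p\<close>, yet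
  \<open>m'\<close> stands before \<open>p\<close> and exceeds it.\<close>

lemma final_split_suffix_length_le:
  assumes "final_split xs A m P T" "final_split xs A' m' P' T'"
  shows "length T \<le> length T'"
proof (rule ccontr)
  assume "\<not> length T \<le> length T'"
  moreover have "(A @ m # P) @ T = (A' @ m' # P') @ T'"
    using assms by (simp add: final_split_def)
  then obtain U where "A @ m # P = (A' @ m' # P') @ U \<and> U @ T = T' \<or>
      (A @ m # P) @ U = A' @ m' # P' \<and> T = U @ T'"
    unfolding append_eq_append_conv2 by blast
  ultimately have U: "U \<noteq> []" "T = U @ T'" "A' @ m' # P' = (A @ m # P) @ U"
    by (cases U; auto)+
  \<comment> \<open>Nonemptiness of \<open>P'\<close> supplies the entry \<open>p\<close> for the
    contradiction.\<close>
  obtain Q p where Q: "P' = Q @ [p]"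
    using assms(2) by (metis final_split_def rev_exhaust)
  obtain U' where U': "U = U' @ [p]"
    using U(1,3) Q by (cases U rule: rev_cases) auto
  have "A' @ m' # Q = (A @ m # P) @ U'"
    using U(3) Q U' by simp
  then have "m' \<in> set ((A @ m # P) @ U')"
    by (metis in_set_conv_decomp)
  moreover have "\<forall>x\<in>set A \<union> set P. x < m" "m < p" "\<forall>x\<in>set U'. x < p"
    using assms(1) U(2) U' by (simp_all add: final_split_def sorted_wrt_append)
  then have "\<forall>x\<in>set ((A @ m # P) @ U'). x < p"
    by (auto dest: less_trans)
  moreover have "p < m'"
    using assms(2) Q by (simp add: final_split_def)
  ultimately show False by (meson less_asym)
qed

text \<open>Comparing lengths both ways forces \<open>T = T'\<close>. Then \<open>m\<close> and
  \<open>m'\<close> are both the maximum of the common rest, and its single occurrence fixes the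
  remaining parts.\<close>

lemma final_split_unique:
  assumes "final_split xs A m P T" "final_split xs A' m' P' T'"
  shows "A = A' \<and> m = m' \<and> P = P' \<and> T = T'"
proof -
  have "length T = length T'"
    using assms final_split_suffix_length_le by (meson le_antisym)
  then have T: "T = T'" and eq: "A @ m # P = A' @ m' # P'"
    using assms append_eq_append_conv[of "A @ m # P" "A' @ m' # P'" T T']
    by (simp_all add: final_split_def)
  have "m \<in> set (A' @ m' # P')" "m' \<in> set (A @ m # P)"
    using eq by (metis in_set_conv_decomp)+
  moreover have "\<forall>x\<in>set (A @ m # P). x \<le> m" "\<forall>x\<in>set (A' @ m' # P'). x \<le> m'"
    using assms by (auto simp: final_split_def intro: less_imp_le)
  ultimately have "m = m'" by (meson le_antisym)
  moreover have "m \<notin> set A" "m \<notin> set P" "m' \<notin> set A'" "m' \<notin> set P'"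
    using assms by (auto simp: final_split_def)
  ultimately show ?thesis
    using T eq by (metis append_Cons_eq_iff)
qed

text \<open>Each entry of \<open>T\<close> exceeds everything to its left, in \<open>A\<close> and
  in \<open>T\<close> alike.\<close>

lemma sorted_wrt_if_all_ltr_maxima:
  assumes "distinct (A @ T)" "set T \<subseteq> set (ltr_maxima (A @ T))"
  shows "sorted_wrt (<) T \<and> (\<forall>a\<in>set A. \<forall>t\<in>set T. a < t)"
proof -
  have less: "\<forall>a\<in>set (A @ U). a < t" if "T = U @ t # V" for U t V
    using assms that in_ltr_maxima_iff[of "A @ U" t V] by simp
  then have "\<forall>a\<in>set A. a < t" if "t \<in> set T" for t
    using that by (metis Un_iff set_append split_list)
  moreover have "sorted_wrt (<) T"
    unfolding sorted_wrt_iff_nth_less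
  proof (intro allI impI)
    fix i j assume "i < j" "j < length T"
    then have "T = take j T @ T ! j # drop (Suc j) T" by (intro id_take_nth_drop)
    moreover have "T ! i \<in> set (take j T)"
      using \<open>i < j\<close> \<open>j < length T\<close> by (auto simp: in_set_conv_nth intro!: exI[of _ i])
    ultimately show "T ! i < T ! j" using less by (metis Un_iff set_append)
  qed
  ultimately show ?thesis by blast
qed

section \<open>LTR-max decompositions: passage to final splits, and existence\<close>

lemma factor_product_0 [simp]: "factor_product M P 0 = []"
  by (simp add: factor_product_def)

lemma factor_product_Suc [simp]:
  "factor_product M P (Suc j) = factor_product M P j @ M (Suc j) @ P (Suc j)"
  by (simp add: factor_product_def)

lemma factor_product_cong:
  "(\<And>i. 1 \<le> i \<Longrightarrow> i \<le> j \<Longrightarrow> M i = M' i \<and> P i = P' i) \<Longrightarrow>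
   factor_product M P j = factor_product M' P' j"
  by (induction j) auto

text \<open>The blocks of LTR maxima give the order relations for \<open>A\<close> and
  \<open>T\<close>. The entries of \<open>P (k - 1)\<close> lie below \<open>m\<close> because none
  of them is a new maximum after \<open>m\<close>.\<close>

lemma final_split_of_decomposition:
  assumes d: "ltr_max_decomposition xs k M P" and "distinct xs" "k \<ge> 2"
  shows "final_split xs (factor_product M P (k - 2) @ butlast (M (k - 1)))
           (last (M (k - 1))) (P (k - 1)) (M k)"
proof -
  define A m Q T where "A = factor_product M P (k - 2) @ butlast (M (k - 1))"
    and "m = last (M (k - 1))" and "Q = P (k - 1)" and "T = M k"
  have k: "k - 1 = Suc (k - 2)" "1 \<le> k - 1" "k - 1 < k" using \<open>k \<ge> 2\<close> by auto
  have ne: "M (k - 1) \<noteq> []" "Q \<noteq> []"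
    using d k by (auto simp: ltr_max_decomposition_def Q_def)
  then have M: "M (k - 1) = butlast (M (k - 1)) @ [m]"
    by (simp add: m_def)
  have "xs = factor_product M P (k - 2) @ M (k - 1) @ Q @ T"
    using d k(1) by (simp add: ltr_max_decomposition_def Q_def T_def)
  then have xs: "xs = A @ m # Q @ T"
    by (subst (asm) M) (simp add: A_def)
  have "m \<in> set (M (k - 1))" using ne by (simp add: m_def)
  then have "m \<in> set (ltr_maxima xs)"
    using d k unfolding ltr_max_decomposition_def by fastforce
  then have A: "\<forall>a\<in>set A. a < m"
    using in_ltr_maxima_iff[of A m "Q @ T"] \<open>distinct xs\<close> xs by simp
  have "set T \<subseteq> set (ltr_maxima xs)"
    using d k(3) unfolding ltr_max_decomposition_def T_def by auto
  then have T: "sorted_wrt (<) T" "\<forall>t\<in>set T. m < t"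
    using sorted_wrt_if_all_ltr_maxima[of "A @ m # Q" T] \<open>distinct xs\<close> xs by auto
  have notin: "set Q \<inter> set (ltr_maxima xs) = {}"
    using d k unfolding ltr_max_decomposition_def Q_def by auto
  \<comment> \<open>Induction over the prefixes \<open>U\<close> of \<open>Q\<close>: the next entry
    is not a maximum, so it is at most some earlier entry, hence at most \<open>m\<close>, and it
    differs from \<open>m\<close>.\<close>
  have "\<forall>x\<in>set U. x < m" if "Q = U @ V" for U V
    using that
  proof (induction U arbitrary: V rule: rev_induct)
    case (snoc u U)
    then have U: "\<forall>x\<in>set U. x < m" by simp
    have xs': "xs = (A @ m # U) @ u # (V @ T)" using xs snoc.prems by simp
    have "u \<notin> set (ltr_maxima xs)" using notin snoc.prems by auto
    then have "\<not> (\<forall>a\<in>set (A @ m # U). a < u)"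
      using in_ltr_maxima_iff[of "A @ m # U" u "V @ T"] \<open>distinct xs\<close> xs' by metis
    then obtain a where "a \<in> set (A @ m # U)" "u \<le> a" by (auto simp: not_less)
    moreover have "a \<le> m" using calculation(1) A U by auto
    moreover have "u \<noteq> m" using \<open>distinct xs\<close> xs' by auto
    ultimately show ?case using U by auto
  qed simp
  then have "\<forall>x\<in>set Q. x < m" by blast
  with xs ne A T show ?thesis
    unfolding A_def[symmetric] m_def[symmetric] Q_def[symmetric] T_def[symmetric]
    by (auto simp: final_split_def)
qed

text \<open>An appended maximum extends \<open>M k\<close>. Any other entry opens a new block
  \<open>P k\<close> if \<open>M k\<close> is nonempty, and extends \<open>P (k - 1)\<close> if
  \<open>M k\<close> is empty.\<close>

lemma ltr_max_decomposition_exists: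
  "distinct xs \<Longrightarrow> \<exists>k M P. ltr_max_decomposition xs k M P"
proof (induction xs rule: rev_induct)
  case Nil
  have "ltr_max_decomposition [] 1 (\<lambda>_. []) (\<lambda>_. [])"
    by (simp add: ltr_max_decomposition_def)
  then show ?case by blast
next
  case (snoc x xs)
  then obtain k M P where d: "ltr_max_decomposition xs k M P" by auto
  have k: "k \<ge> 1" and xs: "xs = factor_product M P (k - 1) @ M k"
    and M: "\<And>i. i \<in> {1..k} \<Longrightarrow> set (M i) \<subseteq> set (ltr_maxima xs)"
    and P: "\<And>i. i \<in> {1..<k} \<Longrightarrow> set (P i) \<inter> set (ltr_maxima xs) = {}"
    and ne: "\<And>i. i \<in> {1..<k} \<Longrightarrow> M i \<noteq> [] \<and> P i \<noteq> []"
    using d by (auto simp: ltr_max_decomposition_def)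
  have sub: "set (P i) \<subseteq> set (factor_product M P j)" if "1 \<le> i" "i \<le> j" for i j
    using that by (induction j) (auto simp: le_Suc_eq)
  have x: "x \<notin> set (P i)" if "i \<in> {1..<k}" for i
  proof -
    have "set (P i) \<subseteq> set xs" using sub[of i "k - 1"] that by (subst xs) fastforce
    then show ?thesis using snoc.prems by auto
  qed
  have "x \<notin> set (ltr_maxima xs)"
    using set_ltr_maxima_subset[of xs] snoc.prems by auto
  consider (max) "\<forall>y\<in>set xs. y < x" | (new) "\<not> (\<forall>y\<in>set xs. y < x)" "M k \<noteq> []"
    | (old) "\<not> (\<forall>y\<in>set xs. y < x)" "M k = []" by blast
  then show ?case
  proof cases
    case max
    let ?M = "M(k := M k @ [x])"
    have fp: "factor_product ?M P (k - 1) = factor_product M P (k - 1)"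
      using k by (intro factor_product_cong) auto
    have lm: "ltr_maxima (xs @ [x]) = ltr_maxima xs @ [x]"
      using max by (simp add: ltr_maxima_snoc)
    have "ltr_max_decomposition (xs @ [x]) k ?M P"
      unfolding ltr_max_decomposition_def lm fp
    proof (intro conjI ballI)
      show "set (?M i) \<subseteq> set (ltr_maxima xs @ [x])" if "i \<in> {1..k}" for i
        using M[OF that] by auto
      show "set (P i) \<inter> set (ltr_maxima xs @ [x]) = {}" if "i \<in> {1..<k}" for i
        using P[OF that] x[OF that] by simp
    qed (use k xs ne in auto)
    then show ?thesis by blast
  next
    case new
    \<comment> \<open>The value of \<open>M\<close> at \<open>Suc k\<close> was arbitrary so far;
      the new final block has to be empty.\<close>
    let ?M = "M(Suc k := [])" and ?P = "P(k := [x])"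
    have "factor_product M P (k - 1) = factor_product ?M ?P (k - 1)"
      using k by (intro factor_product_cong) auto
    moreover have "factor_product ?M ?P k = factor_product ?M ?P (k - 1) @ M k @ [x]"
      using k factor_product_Suc[of ?M ?P "k - 1"] by simp
    ultimately have fp: "xs @ [x] = factor_product ?M ?P (Suc k - 1) @ ?M (Suc k)"
      by (subst xs) simp
    have lm: "ltr_maxima (xs @ [x]) = ltr_maxima xs"
      using new(1) by (simp add: ltr_maxima_snoc)
    have "ltr_max_decomposition (xs @ [x]) (Suc k) ?M ?P"
      unfolding ltr_max_decomposition_def lm
    proof (intro conjI ballI)
      show "set (?M i) \<subseteq> set (ltr_maxima xs)" if "i \<in> {1..Suc k}" for i
        using M[of i] that by auto
      show "set (?P i) \<inter> set (ltr_maxima xs) = {}" if "i \<in> {1..<Suc k}" for i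
        using P[of i] that \<open>x \<notin> set (ltr_maxima xs)\<close> by auto
      show "?M i \<noteq> []" "?P i \<noteq> []" if "i \<in> {1..<Suc k}" for i
        using ne[of i] that new(2) by (cases "i = k"; auto)+
    qed (use fp in auto)
    then show ?thesis by blast
  next
    case old
    \<comment> \<open>With \<open>k = 1\<close> and \<open>M k = []\<close> the list
      \<open>xs\<close> would be empty and \<open>x\<close> vacuously a maximum.\<close>
    then have "k \<noteq> 1" using xs by auto
    let ?P = "P(k - 1 := P (k - 1) @ [x])"
    have s: "k - 1 = Suc (k - 2)" using k \<open>k \<noteq> 1\<close> by simp
    have "factor_product M P (k - 2) = factor_product M ?P (k - 2)"
      using s by (intro factor_product_cong) auto
    then have fp: "xs @ [x] = factor_product M ?P (k - 1) @ M k"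
      using old(2) s by (subst xs) simp
    have lm: "ltr_maxima (xs @ [x]) = ltr_maxima xs"
      using old(1) by (simp add: ltr_maxima_snoc)
    have "ltr_max_decomposition (xs @ [x]) k M ?P"
      unfolding ltr_max_decomposition_def lm
    proof (intro conjI ballI)
      show "set (?P i) \<inter> set (ltr_maxima xs) = {}" if "i \<in> {1..<k}" for i
        using P[OF that] \<open>x \<notin> set (ltr_maxima xs)\<close> by auto
      show "?P i \<noteq> []" if "i \<in> {1..<k}" for i
        using ne[OF that] by simp
    qed (use k M ne fp in auto)
    then show ?thesis by blast
  qed
qed

text \<open>For \<open>k = 1\<close> the whole list is one block of LTR maxima, hence
  increasing.\<close>

lemma decomposition_of_unsorted:
  assumes "distinct xs" "\<not> sorted_wrt (<) xs" "ltr_max_decomposition xs k M P"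
  shows "k \<ge> 2"
proof (rule ccontr)
  assume "\<not> k \<ge> 2"
  then have "k = 1" using assms(3) by (simp add: ltr_max_decomposition_def)
  then have "xs = M 1" "set (M 1) \<subseteq> set (ltr_maxima xs)"
    using assms(3) by (auto simp: ltr_max_decomposition_def)
  then have "set xs \<subseteq> set (ltr_maxima xs)" by metis
  then show False
    using sorted_wrt_if_all_ltr_maxima[of "[]" xs] assms by simp
qed

section \<open>Inserting the greatest entry\<close>

text \<open>The maxima of \<open>L @ R\<close> not coming from \<open>L\<close> exceed
  \<open>m\<close>, so they lie in \<open>T\<close>, where only larger entries follow them.\<close>

lemma queuesort_insert_right:
  assumes fs: "final_split (L @ R) A m P T" and "L = A @ m # U" and "distinct (L @ R)"
  shows "foldr bubble (ltr_maxima L) (L @ R) = queuesort (L @ R)"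
proof -
  obtain ms where ms: "ltr_maxima (L @ R) = ltr_maxima L @ ms" "set ms \<subseteq> set R"
    by (rule ltr_maxima_append)
  have "bubble x (L @ R) = L @ R" if "x \<in> set ms" for x
  proof -
    have "x \<in> set R" "x \<in> set (ltr_maxima (L @ R))" using that ms by auto
    then obtain R1 R2 where R: "R = R1 @ x # R2" by (metis split_list)
    have "\<forall>a\<in>set (L @ R1). a < x"
      using in_ltr_maxima_iff[of "L @ R1" x R2] \<open>x \<in> set (ltr_maxima (L @ R))\<close> R assms(3) by simp
    then have "m < x" using assms(2) by simp
    moreover have "set (L @ R) = set (A @ m # P @ T)" using fs by (simp add: final_split_def)
    then have "x \<in> set (A @ m # P @ T)" using \<open>x \<in> set R\<close> by auto
    ultimately have "x \<in> set T"
      using fs by (auto simp: final_split_def dest: less_asym)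
    then obtain T1 T2 where T: "T = T1 @ x # T2" by (metis split_list)
    have LR: "L @ R = (A @ m # P @ T1) @ x # T2"
      using fs T by (simp add: final_split_def)
    have "x \<notin> set (A @ m # P @ T1)" using assms(3) unfolding LR by auto
    moreover have "\<forall>y\<in>set T2. x < y" using fs T by (simp add: final_split_def sorted_wrt_append)
    ultimately show ?thesis unfolding LR by (rule bubble_idle)
  qed
  \<comment> \<open>\<open>foldr\<close> handles \<open>ms\<close> before the maxima of
    \<open>L\<close>, so it suffices that the entries of \<open>ms\<close> do not move in the
    original list \<open>L @ R\<close>.\<close>
  then show ?thesis
    using ms by (simp add: queuesort_def foldr_bubble_idle)
qed

text \<open>\<open>m\<close> exceeds every entry of \<open>L @ R\<close> and thus is a barrier for
  all maxima of \<open>L\<close>.\<close>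

lemma foldr_bubble_insert_left:
  assumes "final_split xs (L @ R) m P T" "distinct xs"
  shows "foldr bubble (ltr_maxima L) xs = foldr bubble (ltr_maxima L) (L @ R) @ m # P @ T"
proof -
  have "\<forall>x\<in>set (ltr_maxima L). x < m \<and> x \<notin> set (P @ T)"
    using assms set_ltr_maxima_subset[of L] by (fastforce simp: final_split_def)
  then have "foldr bubble (ltr_maxima L) ((L @ R) @ m # (P @ T)) =
      foldr bubble (ltr_maxima L) (L @ R) @ m # (P @ T)"
    by (rule foldr_bubble_append_right)
  then show ?thesis
    using assms(1) by (simp add: final_split_def)
qed

text \<open>Used contrapositively: an unsorted result comes from an unsorted list, which therefore
  has a final split.\<close>

lemma foldr_bubble_sorted:
  assumes "sorted_wrt (<) xs"
  shows "foldr bubble ms xs = xs"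
proof (rule foldr_bubble_idle, intro ballI)
  fix m
  show "bubble m xs = xs"
  proof (cases "m \<in> set xs")
    case True
    then obtain U V where "xs = U @ m # V" by (metis split_list)
    with assms show ?thesis
      by (auto simp: sorted_wrt_append intro!: bubble_idle)
  qed simp
qed

text \<open>This is the characterization freed from standardization and block decompositions. In
  \<open>case1\<close> the pivot of the final split of \<open>L @ R\<close> lies in
  \<open>R\<close>, in \<open>case2\<close> it lies in \<open>L\<close>; uniqueness of the split
  makes the cases exclusive.\<close>

lemma queuesort_preimage_cases:
  assumes fs: "final_split \<pi>' A \<mu> P T"
    and L: "\<forall>x\<in>set L. x < n" and R: "\<forall>x\<in>set R. x < n" and "distinct (L @ R)"
  defines "case1 \<equiv> \<exists>R1. R = R1 @ \<mu> # P @ T \<and> queuesort (L @ n # R1) = A @ [n]"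
    and "case2 \<equiv> queuesort (L @ R) = \<pi>' \<and>
      (\<exists>A' \<mu>' P' T' U. final_split (L @ R) A' \<mu>' P' T' \<and> L = A' @ \<mu>' # U)"
  shows "queuesort (L @ n # R) = \<pi>' @ [n] \<longleftrightarrow> case1 \<or> case2" "\<not> (case1 \<and> case2)"
proof -
  let ?F = "foldr bubble (ltr_maxima L)"
  have q: "queuesort (L @ n # R) = ?F (L @ R) @ [n]"
    by (rule queuesort_Cons_greatest[OF L R])
  \<comment> \<open>\<open>L @ R1\<close> has the same entries as \<open>A\<close>, all below
    \<open>\<mu>\<close>, so the split of \<open>\<pi>'\<close> carries over to
    \<open>L @ R\<close>.\<close>
  have split1: "final_split (L @ R) (L @ R1) \<mu> P T"
    if "R = R1 @ \<mu> # P @ T" "queuesort (L @ n # R1) = A @ [n]" for R1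
  proof -
    have "?F (L @ R1) = A"
      using that queuesort_Cons_greatest[of L n R1] L R by simp
    then have "set (L @ R1) = set A" by (metis set_foldr_bubble)
    then show ?thesis using fs that by (auto simp: final_split_def)
  qed
  show "\<not> (case1 \<and> case2)"
  proof
    assume c: "case1 \<and> case2"
    then obtain R1 where "final_split (L @ R) (L @ R1) \<mu> P T"
      using split1 by (auto simp: case1_def)
    moreover obtain A' \<mu>' P' T' U where "final_split (L @ R) A' \<mu>' P' T'" "L = A' @ \<mu>' # U"
      using c by (auto simp: case2_def)
    \<comment> \<open>The first split puts the pivot behind \<open>L\<close>, the second inside
      \<open>L\<close>.\<close>
    ultimately have "(A' @ \<mu>' # U) @ R1 = A'" using final_split_unique by blast
    then show False by simp
  qed
  show "queuesort (L @ n # R) = \<pi>' @ [n] \<longleftrightarrow> case1 \<or> case2"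
  proof
    assume "case1 \<or> case2"
    then show "queuesort (L @ n # R) = \<pi>' @ [n]"
    proof
      assume case1
      then obtain R1 where R1: "R = R1 @ \<mu> # P @ T" "queuesort (L @ n # R1) = A @ [n]"
        by (auto simp: case1_def)
      have "?F (L @ R1) = A"
        using R1 queuesort_Cons_greatest[of L n R1] L R by simp
      then show ?thesis
        using q foldr_bubble_insert_left[OF split1[OF R1] assms(4)] fs by (simp add: final_split_def)
    next
      assume case2
      then obtain A' \<mu>' P' T' U where *: "final_split (L @ R) A' \<mu>' P' T'" "L = A' @ \<mu>' # U"
        unfolding case2_def by blast
      have "?F (L @ R) = \<pi>'"
        using queuesort_insert_right[OF * assms(4)] \<open>case2\<close> by (simp only: case2_def)
      then show ?thesis using q by simp
    qed
  next
    assume "queuesort (L @ n # R) = \<pi>' @ [n]"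
    then have F: "?F (L @ R) = \<pi>'" using q by simp
    have "\<not> sorted_wrt (<) \<pi>'"
      using fs by (cases P) (auto simp: final_split_def sorted_wrt_append)
    then have "\<not> sorted_wrt (<) (L @ R)"
      using F foldr_bubble_sorted by metis
    moreover obtain s N Q where "ltr_max_decomposition (L @ R) s N Q"
      using ltr_max_decomposition_exists[OF assms(4)] by blast
    ultimately obtain A' \<mu>' P' T' where fs': "final_split (L @ R) A' \<mu>' P' T'"
      using final_split_of_decomposition decomposition_of_unsorted assms(4) by blast
    then have "L @ R = A' @ \<mu>' # P' @ T'" by (simp add: final_split_def)
    \<comment> \<open>The labels tell on which side of the pivot \<open>\<mu>'\<close> the entry
      \<open>n\<close> was inserted.\<close>
    then consider (left) R1 where "A' = L @ R1" "R = R1 @ \<mu>' # P' @ T'"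
      | (right) U where "L = A' @ \<mu>' # U"
      by (auto simp: append_eq_append_conv2 append_eq_Cons_conv)
    then show "case1 \<or> case2"
    proof cases
      case left
      have F': "?F (L @ R) = ?F A' @ \<mu>' # P' @ T'"
        using foldr_bubble_insert_left[of "L @ R" L R1] fs' assms(4) left(1) by simp
      \<comment> \<open>Bubbling rearranges \<open>A'\<close> only among its own entries, which stay
        below \<open>\<mu>'\<close>. Uniqueness then identifies this split of \<open>\<pi>'\<close>
        with the given one.\<close>
      then have "final_split \<pi>' (?F A') \<mu>' P' T'"
        using fs' F by (auto simp: final_split_def)
      then have "?F A' = A" "\<mu>' = \<mu>" "P' = P" "T' = T"
        using final_split_unique[OF fs] by auto
      then have case1
        using left L R queuesort_Cons_greatest[of L n R1] by (simp add: case1_def)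
      then show ?thesis ..
    next
      case right
      then have case2
        unfolding case2_def using F fs' queuesort_insert_right[OF fs' right assms(4)] by metis
      then show ?thesis ..
    qed
  qed
qed

text \<open>After writing \<open>\<sigma> = L @ n # R\<close> and splitting \<open>n\<close> off the
  end of \<open>\<pi>\<close>, each case is translated into its counterpart in
  \<open>queuesort_preimage_cases\<close>; the insertion position \<open>j\<close> becomes
  \<open>length L\<close>.\<close>

theorem theorem3p7:
  fixes n k :: nat and \<pi> \<sigma> :: "nat list" and M P :: "nat \<Rightarrow> nat list"
  assumes "n \<ge> 1"
    and "\<pi> \<in> permutations_of_set {1..n}"
    and "ltr_max_decomposition \<pi> k M P"
    and "M k \<noteq> []"
    and "\<pi> \<noteq> [1..<Suc n]"
    and "\<sigma> \<in> permutations_of_set {1..n}"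
  shows "queuesort \<sigma> = \<pi> \<longleftrightarrow>
    (let \<rho> = factor_product M P (k - 2) @ butlast (M (k - 1));
         case1 =
           (\<exists>\<tau>. \<tau> \<in> permutations_of_set (set \<rho> \<union> {n}) \<and>
                queuesort (standardize \<tau>) = standardize (\<rho> @ [n]) \<and>
                \<sigma> = \<tau> @ [last (M (k - 1))] @ P (k - 1) @ remove1 n (M k));
         case2 =
           (\<exists>\<sigma>' s N R j.
                \<sigma>' \<in> permutations_of_set {1..n - 1} \<and>
                queuesort \<sigma>' = remove1 n \<pi> \<and>
                ltr_max_decomposition \<sigma>' s N R \<and> s \<ge> 2 \<and>
                length (factor_product N R (s - 2) @ N (s - 1)) \<le> j \<and> j \<le> length \<sigma>' \<and>
                \<sigma> = take j \<sigma>' @ [n] @ drop j \<sigma>')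
     in (case1 \<and> \<not> case2) \<or> (\<not> case1 \<and> case2))"
proof -
  have "distinct \<pi>" and set_\<pi>: "set \<pi> = {1..n}" and "distinct \<sigma>" and set_\<sigma>: "set \<sigma> = {1..n}"
    using assms(2,6) by (auto simp: permutations_of_set_def)
  have "\<not> sorted_wrt (<) \<pi>"
  proof
    assume "sorted_wrt (<) \<pi>"
    then have "\<pi> = sorted_list_of_set {1..n}"
      using set_\<pi> by (metis finite_atLeastAtMost strict_sorted_equal
          strict_sorted_list_of_set set_sorted_list_of_set)
    then show False using assms(5) by (metis atLeastLessThanSuc_atLeastAtMost sorted_list_of_set_range)
  qed
  then have "k \<ge> 2" using decomposition_of_unsorted \<open>distinct \<pi>\<close> assms(3) by blast
  define A \<mu> Q where "A = factor_product M P (k - 2) @ butlast (M (k - 1))"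
    and "\<mu> = last (M (k - 1))" and "Q = P (k - 1)"
  have fs0: "final_split \<pi> A \<mu> Q (M k)"
    unfolding A_def \<mu>_def Q_def
    using final_split_of_decomposition assms(3) \<open>distinct \<pi>\<close> \<open>k \<ge> 2\<close> by blast
  \<comment> \<open>The last entry \<open>t\<close> exceeds all others by the final split, and so
    turns out to be \<open>n\<close>.\<close>
  obtain T t where T: "M k = T @ [t]" using assms(4) by (metis rev_exhaust)
  have \<pi>t: "\<pi> = (A @ \<mu> # Q @ T) @ [t]" and "\<mu> < t" and "\<forall>x\<in>set T. x < t"
    and fs: "final_split (A @ \<mu> # Q @ T) A \<mu> Q T"
    using fs0 unfolding T final_split_def by (simp_all add: sorted_wrt_append)
  then have "\<forall>x\<in>set (A @ \<mu> # Q @ T). x < t"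
    unfolding final_split_def by (auto dest: less_trans)
  then have "\<forall>x\<in>set \<pi>. x \<le> t" "t \<in> set \<pi>"
    using \<pi>t by (auto simp: less_imp_le)
  then have "t = n" using set_\<pi> assms(1) by (simp add: le_antisym)
  with \<pi>t have \<pi>: "\<pi> = (A @ \<mu> # Q @ T) @ [n]" by simp
  have "n \<notin> set (A @ \<mu> # Q @ T)" using \<pi> \<open>distinct \<pi>\<close> by auto
  then have rem: "remove1 n \<pi> = A @ \<mu> # Q @ T" "remove1 n (M k) = T"
    using \<pi> T \<open>t = n\<close> by (simp_all add: remove1_append)
  have "n \<in> set \<sigma>" using assms(1) set_\<sigma> by simp
  then obtain L R where \<sigma>: "\<sigma> = L @ n # R" by (metis split_list)
  have dLR: "distinct (L @ R)" and nLR: "n \<notin> set L" "n \<notin> set R"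
    using \<open>distinct \<sigma>\<close> \<sigma> by auto
  have "set (L @ R) = {1..n} - {n}" using set_\<sigma> nLR \<sigma> by auto
  moreover have "{1..n} - {n} = {1..n - 1}" by auto
  ultimately have set_LR: "set (L @ R) = {1..n - 1}" by (simp only:)
  have "\<forall>x\<in>set (L @ R). x < n" unfolding set_LR using assms(1) by auto
  then have L: "\<forall>x\<in>set L. x < n" and R: "\<forall>x\<in>set R. x < n" by auto
  have n_unique: "U = L \<and> V = R" if "\<sigma> = U @ n # V" for U V
    using that \<sigma> nLR append_Cons_eq_iff[of n L R U V] by simp

  have case1: "(\<exists>\<tau>. \<tau> \<in> permutations_of_set (set A \<union> {n}) \<and>
        queuesort (standardize \<tau>) = standardize (A @ [n]) \<and> \<sigma> = \<tau> @ [\<mu>] @ Q @ T) \<longleftrightarrow>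
      (\<exists>R1. R = R1 @ \<mu> # Q @ T \<and> queuesort (L @ n # R1) = A @ [n])"
    (is "?l \<longleftrightarrow> ?r")
  proof
    assume ?l
    then obtain \<tau> where \<tau>: "set \<tau> = set (A @ [n])" "\<sigma> = \<tau> @ \<mu> # Q @ T"
      "queuesort (standardize \<tau>) = standardize (A @ [n])"
      by (auto simp: permutations_of_set_def)
    then have "queuesort \<tau> = A @ [n]" using queuesort_standardize_eq_iff by blast
    \<comment> \<open>The occurrence of \<open>n\<close> in \<open>\<sigma>\<close> thus falls into
      \<open>\<tau>\<close>, so \<open>L\<close> is a prefix of \<open>\<tau>\<close>.\<close>
    moreover have "n \<in> set \<tau>" using \<tau>(1) by simp
    then obtain U V where UV: "\<tau> = U @ n # V" by (metis split_list)
    moreover have "U = L \<and> V @ \<mu> # Q @ T = R" using n_unique \<tau>(2) UV by simp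
    ultimately show ?r by auto
  next
    assume ?r
    then obtain R1 where R1: "R = R1 @ \<mu> # Q @ T" "queuesort (L @ n # R1) = A @ [n]" by blast
    then have "set (L @ n # R1) = set (A @ [n])" by (metis set_queuesort)
    moreover from this have "queuesort (standardize (L @ n # R1)) = standardize (A @ [n])"
      using R1(2) queuesort_standardize_eq_iff by blast
    moreover have "distinct (L @ n # R1)" using \<open>distinct \<sigma>\<close> \<sigma> R1(1) by auto
    ultimately show ?l
      using \<sigma> R1(1) by (intro exI[of _ "L @ n # R1"]) (auto simp: permutations_of_set_def)
  qed

  have case2: "(\<exists>\<sigma>' s N S j. \<sigma>' \<in> permutations_of_set {1..n - 1} \<and>
        queuesort \<sigma>' = A @ \<mu> # Q @ T \<and> ltr_max_decomposition \<sigma>' s N S \<and> s \<ge> 2 \<and>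
        length (factor_product N S (s - 2) @ N (s - 1)) \<le> j \<and> j \<le> length \<sigma>' \<and>
        \<sigma> = take j \<sigma>' @ [n] @ drop j \<sigma>') \<longleftrightarrow>
      queuesort (L @ R) = A @ \<mu> # Q @ T \<and>
      (\<exists>A' \<mu>' P' T' U. final_split (L @ R) A' \<mu>' P' T' \<and> L = A' @ \<mu>' # U)"
    (is "?l \<longleftrightarrow> ?r")
  proof
    assume ?l
    then obtain \<sigma>' s N S j where *: "\<sigma>' \<in> permutations_of_set {1..n - 1}"
      "queuesort \<sigma>' = A @ \<mu> # Q @ T" "ltr_max_decomposition \<sigma>' s N S" "s \<ge> 2"
      "length (factor_product N S (s - 2) @ N (s - 1)) \<le> j" "j \<le> length \<sigma>'"
      "\<sigma> = take j \<sigma>' @ n # drop j \<sigma>'" by auto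
    have j: "L = take j \<sigma>'" "R = drop j \<sigma>'" using n_unique *(7) by auto
    let ?A = "factor_product N S (s - 2) @ butlast (N (s - 1))" and ?m = "last (N (s - 1))"
    have fs': "final_split \<sigma>' ?A ?m (S (s - 1)) (N s)"
      using final_split_of_decomposition * by (auto simp: permutations_of_set_def)
    have "N (s - 1) \<noteq> []" using *(3,4) by (auto simp: ltr_max_decomposition_def)
    \<comment> \<open>\<open>butlast\<close> and \<open>last\<close> together have the length of
      \<open>N (s - 1)\<close>, so the bound on \<open>j\<close> says that the prefix reaches past
      the pivot.\<close>
    then have len: "length (?A @ [?m]) \<le> j" using *(5) by (cases "N (s - 1)") auto
    have "\<sigma>' = (?A @ [?m]) @ S (s - 1) @ N s" using fs' by (simp add: final_split_def)
    then have "take j \<sigma>' = (?A @ [?m]) @ take (j - length (?A @ [?m])) (S (s - 1) @ N s)"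
      using len by (metis take_all take_append)
    then have "L = ?A @ ?m # take (j - length (?A @ [?m])) (S (s - 1) @ N s)"
      using j by simp
    then show ?r using fs' *(2) j by (metis append_take_drop_id)
  next
    assume ?r
    then obtain A' \<mu>' P' T' U where r: "queuesort (L @ R) = A @ \<mu> # Q @ T"
      "final_split (L @ R) A' \<mu>' P' T'" "L = A' @ \<mu>' # U" by blast
    \<comment> \<open>The first entry of the nonempty \<open>P'\<close> is smaller than
      \<open>\<mu>'\<close> before it.\<close>
    have "\<not> sorted_wrt (<) (L @ R)"
      using r(2) by (cases P') (auto simp: final_split_def sorted_wrt_append)
    moreover obtain s N S where d: "ltr_max_decomposition (L @ R) s N S"
      using ltr_max_decomposition_exists[OF dLR] by blast
    ultimately have s: "s \<ge> 2" using decomposition_of_unsorted dLR by blast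
    then have A': "factor_product N S (s - 2) @ butlast (N (s - 1)) = A'"
      using final_split_unique[OF final_split_of_decomposition[OF d dLR s] r(2)] by simp
    have "N (s - 1) \<noteq> []" using d s by (auto simp: ltr_max_decomposition_def)
    \<comment> \<open>The extra one counts the pivot, which \<open>butlast\<close> leaves out of
      \<open>A'\<close>.\<close>
    then have "length (factor_product N S (s - 2) @ N (s - 1)) = Suc (length A')"
      unfolding A'[symmetric] by simp
    then have "length (factor_product N S (s - 2) @ N (s - 1)) \<le> length L" using r(3) by simp
    moreover have "L @ R \<in> permutations_of_set {1..n - 1}"
      using dLR set_LR by (simp add: permutations_of_set_def)
    moreover have "\<sigma> = take (length L) (L @ R) @ [n] @ drop (length L) (L @ R)"
      "length L \<le> length (L @ R)" using \<sigma> by simp_all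
    ultimately show ?l using r(1) d s by blast
  qed

  show ?thesis
    unfolding Let_def A_def[symmetric] \<mu>_def[symmetric] Q_def[symmetric] rem case1 case2
    using queuesort_preimage_cases[OF fs L R dLR] unfolding \<sigma>[symmetric] \<pi>[symmetric] by blast
qed

end
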